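(* There exist positive constants $a_1,a_2,a_3$ such that the following holds. Let $S$ be a $2$-colored set of $n$ points in general position in $\mathbb{R}^2$, partitioned into a red point set $R$ and a blue point set $B$. Then either there exist at least $a_1 n^{4/3}$ empty red triangles, or there exists a convex set $C\subseteq\mathbb{R}^2$ such that $|S\cap C|\ge a_2 n$ and $\delta(S\cap C)=\big||C\cap R|-|C\cap B|\big|\ge a_3\sqrt[3]{n}$. (In the paper's notation: $\Omega(n^{4/3})$ empty red triangles, or $|S\cap C|=\Theta(n)$ and $\delta(S\cap C)=\Omega(\sqrt[3]{n})$.)
   Context: General position in the plane: no three points collinear. A triangle with vertex set $S'\subseteq S$ is empty if $\mathrm{Conv}(S')\cap S=S'$; it is red if all three vertices are in $R$. For a two-colored set the discrepancy is the absolute difference of the sizes of the two color classes. *)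

theory Defs
  imports "HOL-Analysis.Analysis"
begin

definition general_position :: "(real^2) set \<Rightarrow> bool" where
  "general_position S \<longleftrightarrow> (\<forall>T\<subseteq>S. card T = 3 \<longrightarrow> \<not> collinear T)"

text \<open>A triangle with vertices in \<^term>\<open>S\<close> is identified with its set of three vertices.\<close>

definition empty_triangle :: "(real^2) set \<Rightarrow> (real^2) set \<Rightarrow> bool" where
  "empty_triangle S T \<longleftrightarrow> T \<subseteq> S \<and> card T = 3 \<and> convex hull T \<inter> S = T"

definition empty_red_triangles :: "(real^2) set \<Rightarrow> (real^2) set \<Rightarrow> (real^2) set set" where
  "empty_red_triangles S R = {T. empty_triangle S T \<and> T \<subseteq> R}"

definition discrepancy :: "(real^2) set \<Rightarrow> (real^2) set \<Rightarrow> (real^2) set \<Rightarrow> real" where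
  "discrepancy R B X = \<bar>real (card (X \<inter> R)) - real (card (X \<inter> B))\<bar>"

end

theory Submission
  imports Defs
begin

text \<open>
  Put \<open>k = n\<^sup>1\<^sup>/\<^sup>3\<close> and suppose that every convex set with at least \<open>n/8\<close> points has discrepancy
  below \<open>k/64\<close>. Red points are deleted one at a time, always an extreme point of the remaining red
  set \<open>X\<close>, as long as \<open>|X| > n/4\<close>; each deletion is to destroy at least \<open>k/3\<close> empty red triangles.

  Balance of \<open>conv X\<close> bounds the number of blue points in it by \<open>|X| + k/64\<close>. Removing the
  extreme points from \<open>conv X\<close> leaves a convex set with the same blue points, and its balance shows
  that there are only \<open>h < k/32\<close> extreme points. The star of an extreme point \<open>p\<close> consists of
  \<open>|X| - 2\<close> triangles without red points, each blue point spoiling at most one of them. To gain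
  more, take from the fan triangulation of \<open>conv X\<close> at \<open>p\<close> the triangle \<open>puv\<close> with the most red points
  in it, at least \<open>|X|/h - 1\<close>, a number of order \<open>k\<^sup>2\<close>. Two interior points \<open>c, q\<close> of \<open>puv\<close> are always
  nested (\<open>c \<in> puq\<close> or \<open>q \<in> puc\<close>) or (\<open>c \<in> uvq\<close> or \<open>q \<in> uvc\<close>), and each step of a nested chain over
  the side \<open>pu\<close>, or over \<open>uv\<close>, allows one more disjoint triangle with a corner in \<open>p, u, v\<close>.
  An Erdos-Szekeres labelling yields a gain of order \<open>k\<close>, which outweighs the discrepancy, so one of
  \<open>p, u, v\<close> is a vertex of at least \<open>k/3\<close> empty red triangles.
\<close>

section \<open>Orientation of triples and angular order in the plane\<close>

definition orient :: "real^2 \<Rightarrow> real^2 \<Rightarrow> real^2 \<Rightarrow> real" where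
  "orient a b c = (b$1 - a$1) * (c$2 - a$2) - (b$2 - a$2) * (c$1 - a$1)"

lemma orient_rotate: "orient a b c = orient b c a"
  by (simp add: orient_def algebra_simps)

lemma orient_swap: "orient a c b = - orient a b c"
  by (simp add: orient_def algebra_simps)

lemma orient_degenerate [simp]: "orient a b a = 0" "orient a b b = 0" "orient a a b = 0"
  by (simp_all add: orient_def)

lemma orient_zero_imp_collinear:
  assumes "orient a b c = 0"
  shows "collinear {a, b, c}"
proof (cases "a = b")
  case False
  define x where "x = b - a"
  define y where "y = c - a"
  have *: "x$1 * y$2 = x$2 * y$1"
    using assms by (simp add: orient_def x_def y_def)
  have x: "x \<noteq> 0" using False by (simp add: x_def)
  hence n: "x$1 * x$1 + x$2 * x$2 \<noteq> 0"
    by (auto simp: vec_eq_iff forall_2 add_nonneg_eq_0_iff)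
  have "y = ((x$1 * y$1 + x$2 * y$2) / (x$1 * x$1 + x$2 * x$2)) *\<^sub>R x"
    using n * by (simp add: vec_eq_iff forall_2 field_simps)
  hence "collinear {0, x, y}" by (auto simp: collinear_lemma)
  hence "collinear {b, a, c}"
    by (subst collinear_3) (auto simp: x_def y_def)
  thus ?thesis by (simp add: insert_commute)
qed auto

lemma orient_affine:
  assumes "u + v = 1"
  shows "orient a b (u *\<^sub>R x + v *\<^sub>R y) = u * orient a b x + v * orient a b y"
proof -
  have v: "v = 1 - u" using assms by simp
  show ?thesis unfolding v by (simp add: orient_def algebra_simps)
qed

lemma convex_orient_le: "convex {x. orient a b x \<le> 0}"
  and convex_orient_ge: "convex {x. orient a b x \<ge> 0}"
  and convex_orient_gt: "convex {x. orient a b x > 0}"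
proof -
  note lin = orient_affine
  show "convex {x. orient a b x \<ge> 0}"
    by (auto simp: convex_def lin)
  show "convex {x. orient a b x \<le> 0}"
    by (auto simp: convex_def lin intro!: add_nonpos_nonpos mult_nonneg_nonpos)
  show "convex {x. orient a b x > 0}"
    unfolding convex_def
    by (auto simp: lin) (smt (verit) mult_nonneg_nonneg mult_pos_pos)
qed

text \<open>Divided by \<open>orient a b c\<close>, the orientations of \<open>x\<close> against the
  three sides are its barycentric coordinates, as ratios of signed areas.\<close>

lemma in_triangle_if_orient_nonneg:
  assumes "orient a b c > 0" "orient a b x \<ge> 0" "orient b c x \<ge> 0" "orient c a x \<ge> 0"
  shows "x \<in> convex hull {a, b, c}"
proof -
  define t where "t = orient a b c"
  have s: "orient b c x + orient c a x + orient a b x = t"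
    by (simp add: t_def orient_def algebra_simps)
  have t: "t > 0" using assms by (simp add: t_def)
  have "orient b c x *\<^sub>R a + orient c a x *\<^sub>R b + orient a b x *\<^sub>R c = t *\<^sub>R x"
    by (simp add: vec_eq_iff forall_2 t_def orient_def algebra_simps)
  hence "(1/t) *\<^sub>R (orient b c x *\<^sub>R a + orient c a x *\<^sub>R b + orient a b x *\<^sub>R c) = x"
    using t by simp
  hence "x = (orient b c x / t) *\<^sub>R a + (orient c a x / t) *\<^sub>R b + (orient a b x / t) *\<^sub>R c"
    by (simp add: scaleR_add_right)
  moreover have "orient b c x / t + orient c a x / t + orient a b x / t = 1"
    using s t by (simp add: add_divide_distrib [symmetric])
  ultimately show ?thesis
    unfolding convex_hull_3 mem_Collect_eq using assms t
    by (intro exI[of _ "orient b c x / t"] exI[of _ "orient c a x / t"] exI[of _ "orient a b x / t"]) auto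
qed

text \<open>Angular order around \<open>p\<close> inside the half-plane \<open>d \<bullet> (x - p) > 0\<close>.\<close>

definition slope :: "real^2 \<Rightarrow> real^2 \<Rightarrow> real^2 \<Rightarrow> real" where
  "slope d p x = (d$1 * (x - p)$2 - d$2 * (x - p)$1) / (d \<bullet> (x - p))"

text \<open>\<open>slope d p x\<close> is the tangent of the angle from \<open>d\<close> to
  \<open>x - p\<close>. Clearing the positive denominators turns a difference of slopes into the
  squared length of \<open>d\<close> times \<open>orient p x y\<close>.\<close>

lemma orient_pos_iff_slope_less:
  assumes "d \<bullet> (x - p) > 0" "d \<bullet> (y - p) > 0"
  shows "orient p x y > 0 \<longleftrightarrow> slope d p x < slope d p y"
proof -
  have "d \<noteq> 0" using assms by auto
  hence d: "d$1 * d$1 + d$2 * d$2 > 0"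
    by (auto simp: vec_eq_iff forall_2 add_nonneg_eq_0_iff less_le)
  have i: "e \<bullet> z = e$1 * z$1 + e$2 * z$2" for e z :: "real^2"
    by (simp add: inner_vec_def sum_2)
  have *: "(d$1 * (y - p)$2 - d$2 * (y - p)$1) * (d \<bullet> (x - p)) - (d$1 * (x - p)$2 - d$2 * (x - p)$1) * (d \<bullet> (y - p))
       = (d$1 * d$1 + d$2 * d$2) * orient p x y"
    unfolding i orient_def by (simp add: algebra_simps)
  have "slope d p x < slope d p y \<longleftrightarrow>
     (d$1 * (x - p)$2 - d$2 * (x - p)$1) * (d \<bullet> (y - p)) < (d$1 * (y - p)$2 - d$2 * (y - p)$1) * (d \<bullet> (x - p))"
    unfolding slope_def using assms by (simp add: divide_less_eq less_divide_eq mult.commute mult.left_commute)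
  also have "\<dots> \<longleftrightarrow> (d$1 * d$1 + d$2 * d$2) * orient p x y > 0"
    using * by linarith
  finally show ?thesis using d by (simp add: zero_less_mult_iff)
qed

lemma orient_neg_iff_slope_less:
  assumes "d \<bullet> (x - p) > 0" "d \<bullet> (y - p) > 0"
  shows "orient p x y < 0 \<longleftrightarrow> slope d p y < slope d p x"
  using orient_pos_iff_slope_less[OF assms(2,1)] orient_swap[of p x y] by simp

text \<open>Compare the ratios \<open>x1 / x2\<close>, \<open>y1 / y2\<close>,
  \<open>z1 / z2\<close> of barycentric coordinates. If the last is smallest, \<open>c\<close> lies
  in \<open>puq\<close>; if it is largest, \<open>q\<close> lies in \<open>puc\<close>. Otherwise it
  is between the other two, so \<open>x1 / x2\<close> is smallest or largest and the same argument
  works over the side \<open>uv\<close>.\<close>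

lemma triangle_points_comparable:
  fixes p u v c q :: "real^2"
  assumes c: "c = x1 *\<^sub>R p + y1 *\<^sub>R u + z1 *\<^sub>R v" "x1 > 0" "y1 > 0" "z1 > 0" "x1 + y1 + z1 = 1"
    and q: "q = x2 *\<^sub>R p + y2 *\<^sub>R u + z2 *\<^sub>R v" "x2 > 0" "y2 > 0" "z2 > 0" "x2 + y2 + z2 = 1"
  shows "c \<in> convex hull {p, u, q} \<or> q \<in> convex hull {p, u, c} \<or>
         c \<in> convex hull {u, v, q} \<or> q \<in> convex hull {u, v, c}"
proof -
  have key: "c \<in> convex hull {p, u, q}"
    if "z1 * y2 \<le> z2 * y1" "z1 * x2 \<le> z2 * x1"
      "x1 + y1 + z1 = 1" "x2 + y2 + z2 = 1" "z1 > 0" "z2 > 0"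
      "c = x1 *\<^sub>R p + y1 *\<^sub>R u + z1 *\<^sub>R v" "q = x2 *\<^sub>R p + y2 *\<^sub>R u + z2 *\<^sub>R v"
    for x1 y1 z1 x2 y2 z2 :: real and p u v c q :: "real^2"
  proof -
    \<comment> \<open>Taking \<open>l\<close> copies of \<open>q\<close> out of \<open>c\<close>
      cancels the coordinate at \<open>v\<close>; minimality of the ratio keeps the other two
      coordinates nonnegative.\<close>
    define l where "l = z1 / z2"
    have lz: "l * z2 = z1" using that by (simp add: l_def)
    have "c = (x1 - l * x2) *\<^sub>R p + (y1 - l * y2) *\<^sub>R u + l *\<^sub>R q"
      unfolding that(7,8) by (simp add: algebra_simps lz)
    moreover have "l * x2 \<le> x1" "l * y2 \<le> y1" "l \<ge> 0"
      using that by (simp_all add: l_def field_simps)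
    moreover have "(x1 - l * x2) + (y1 - l * y2) + l = 1"
    proof -
      have "l * x2 + l * y2 + l * z2 = l" using that(4) by (metis distrib_left mult.right_neutral)
      thus ?thesis using that(3) lz by linarith
    qed
    ultimately show ?thesis unfolding convex_hull_3 by (smt (verit, best) mem_Collect_eq)
  qed
  have trans: "y2 * x1 \<le> y1 * x2"
    if "z1 * y2 \<le> z2 * y1" "z2 * x1 \<le> z1 * x2" "x1 > 0" "y1 > 0" "z1 > 0" "x2 > 0" "y2 > 0" "z2 > 0"
    for x1 y1 z1 x2 y2 z2 :: real
  proof -
    have "(z1 * y2) * (z2 * x1) \<le> (z2 * y1) * (z1 * x2)"
      using that by (intro mult_mono[OF that(1,2)]) auto
    hence "(z1 * z2) * (y2 * x1) \<le> (z1 * z2) * (y1 * x2)" by (simp add: ac_simps)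
    thus ?thesis using that by simp
  qed
  consider "z1 * y2 \<le> z2 * y1" "z1 * x2 \<le> z2 * x1" | "z1 * y2 \<le> z2 * y1" "z2 * x1 \<le> z1 * x2"
    | "z2 * y1 \<le> z1 * y2" "z2 * x1 \<le> z1 * x2" | "z2 * y1 \<le> z1 * y2" "z1 * x2 \<le> z2 * x1" by linarith
  thus ?thesis
  proof cases
    case 1 thus ?thesis using key[of z1 y2 z2 y1 x2 x1 c p u v q] c q by blast
  next
    case 2
    have "y2 * x1 \<le> y1 * x2" using trans 2 c q by blast
    thus ?thesis using key[of x1 z2 x2 z1 y2 y1 c u v p q] 2 c q by (simp add: ac_simps)
  next
    case 3 thus ?thesis using key[of z2 y1 z1 y2 x1 x2 q p u v c] c q by blast
  next
    case 4
    have "y1 * x2 \<le> y2 * x1" using trans 4 c q by blast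
    thus ?thesis using key[of x2 z1 x1 z2 y1 y2 q u v p c] 4 c q by (simp add: ac_simps)
  qed
qed

lemma finite_obtains_max:
  fixes f :: "'a \<Rightarrow> real"
  assumes "finite A" "A \<noteq> {}"
  obtains u where "u \<in> A" "\<And>x. x \<in> A \<Longrightarrow> f x \<le> f u"
proof -
  have "Max (f ` A) \<in> f ` A" using assms by (intro Max_in) auto
  then obtain u where "u \<in> A" "f u = Max (f ` A)" by (metis imageE)
  thus ?thesis using that[of u] assms by simp
qed

section \<open>Superadditive weights and the star bound\<close>

locale two_colored =
  fixes S R B :: "(real^2) set"
  assumes fin: "finite S" and gp: "general_position S"
    and un: "R \<union> B = S" and disj: "R \<inter> B = {}"
begin

lemma RS: "R \<subseteq> S" and BS: "B \<subseteq> S" and finR: "finite R" and finB: "finite B"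
  using un fin by auto

lemma not_collinear:
  assumes "a \<in> S" "b \<in> S" "c \<in> S" "a \<noteq> b" "a \<noteq> c" "b \<noteq> c"
  shows "\<not> collinear {a, b, c}"
  using gp assms by (auto simp: general_position_def)

lemma on_line_imp_eq:
  assumes "a \<in> S" "b \<in> S" "a \<noteq> b" "x \<in> S" "orient a b x = 0"
  shows "x \<in> {a, b}"
  using not_collinear[of a b x] orient_zero_imp_collinear assms by auto

lemma on_segment_imp_eq:
  assumes "a \<in> S" "b \<in> S" "x \<in> S" "x \<in> convex hull {a, b}"
  shows "x \<in> {a, b}"
proof (cases "a = b")
  case False
  have "collinear {a, x, b}"
    using assms(4) between_imp_collinear[of a b x] by (simp add: between_mem_convex_hull)
  thus ?thesis using not_collinear[of a x b] False assms by auto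
qed (use assms in auto)

definition triangles_at :: "(real^2) set \<Rightarrow> (real^2) set \<Rightarrow> (real^2) set set" where
  "triangles_at K A = {T \<in> empty_red_triangles S R. T \<subseteq> A \<and> T \<inter> K \<noteq> {}}"

text \<open>Counting blue points along with the triangles makes the weight superadditive: in a family of
  non-overlapping triangles, each one without red points contributes at least 1, empty or not.\<close>

definition weight :: "(real^2) set \<Rightarrow> (real^2) set \<Rightarrow> nat" where
  "weight K A = card (triangles_at K A) + card (A \<inter> B)"

lemma finite_empty_red: "finite (empty_red_triangles S R)"
proof (rule finite_subset)
  show "empty_red_triangles S R \<subseteq> Pow R" by (auto simp: empty_red_triangles_def)
qed (use finR in auto)

lemma finite_triangles_at: "finite (triangles_at K A)"
  using finite_empty_red by (simp add: triangles_at_def)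

lemma triangles_at_disjoint:
  assumes "A1 \<inter> A2 \<inter> S \<subseteq> {a, b}"
  shows "triangles_at K A1 \<inter> triangles_at K A2 = {}"
proof (rule equals0I)
  fix T assume "T \<in> triangles_at K A1 \<inter> triangles_at K A2"
  hence "T \<subseteq> A1 \<inter> A2 \<inter> S" "card T = 3"
    by (auto simp: triangles_at_def empty_red_triangles_def empty_triangle_def)
  hence "card T \<le> card {a, b}" using assms by (meson card_mono finite.emptyI finite.insertI order_trans)
  thus False using \<open>card T = 3\<close> by (auto simp: card_insert_if split: if_splits)
qed

text \<open>Two points cannot carry a triangle, and red points are not blue. So regions that share
  at most two points of \<open>S\<close>, both red, contribute disjoint sets of triangles and
  disjoint sets of blue points.\<close>

lemma weight_superadditive:
  assumes "A1 \<subseteq> A" "A2 \<subseteq> A" "A3 \<subseteq> A"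
    and 12: "A1 \<inter> A2 \<inter> S \<subseteq> {a, b}" and 13: "A1 \<inter> A3 \<inter> S \<subseteq> {c, d}" and 23: "A2 \<inter> A3 \<inter> S \<subseteq> {e, f}"
    and R: "{a, b, c, d, e, f} \<subseteq> R"
  shows "weight K A1 + weight K A2 + weight K A3 \<le> weight K A"
proof -
  note fin_t = finite_triangles_at
  have "card (triangles_at K A1) + card (triangles_at K A2) + card (triangles_at K A3)
      = card (triangles_at K A1 \<union> triangles_at K A2 \<union> triangles_at K A3)"
    using triangles_at_disjoint[OF 12] triangles_at_disjoint[OF 13] triangles_at_disjoint[OF 23]
    by (subst card_Un_disjoint; simp add: fin_t Int_Un_distrib2)+
  also have "\<dots> \<le> card (triangles_at K A)"
    using assms by (intro card_mono fin_t) (auto simp: triangles_at_def)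
  finally have 1: "card (triangles_at K A1) + card (triangles_at K A2) + card (triangles_at K A3)
      \<le> card (triangles_at K A)" .
  have disjB: "(U \<inter> B) \<inter> (V \<inter> B) = {}" if "U \<inter> V \<inter> S \<subseteq> W" "W \<subseteq> R" for U V W
    using that BS disj by blast
  have d: "(A1 \<inter> B) \<inter> (A2 \<inter> B) = {}" "(A1 \<inter> B) \<inter> (A3 \<inter> B) = {}" "(A2 \<inter> B) \<inter> (A3 \<inter> B) = {}"
    using disjB[OF 12] disjB[OF 13] disjB[OF 23] R by simp_all
  have "card (A1 \<inter> B) + card (A2 \<inter> B) + card (A3 \<inter> B) = card ((A1 \<inter> B) \<union> (A2 \<inter> B) \<union> (A3 \<inter> B))"
    using d finB by (subst card_Un_disjoint; simp add: Int_Un_distrib2)+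
  also have "\<dots> \<le> card (A \<inter> B)"
    using assms finB by (intro card_mono) auto
  finally show ?thesis using 1 by (simp add: weight_def)
qed

lemma weight_pos_if_empty_of_red:
  assumes "T \<subseteq> R" "card T = 3" "T \<inter> K \<noteq> {}" "convex hull T \<inter> R \<subseteq> T"
  shows "weight K (convex hull T) \<ge> 1"
proof (cases "convex hull T \<inter> B = {}")
  case True
  have "T \<subseteq> convex hull T" by (simp add: hull_subset)
  hence "T \<in> triangles_at K (convex hull T)"
    using assms True un
    by (auto simp: triangles_at_def empty_red_triangles_def empty_triangle_def)
  hence "card (triangles_at K (convex hull T)) \<ge> 1"
    using finite_triangles_at by (metis One_nat_def Suc_leI card_gt_0_iff empty_iff)
  thus ?thesis by (simp add: weight_def)
next
  case False
  hence "card (convex hull T \<inter> B) \<ge> 1"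
    using finB by (metis One_nat_def Suc_leI card_gt_0_iff finite_Int)
  thus ?thesis by (simp add: weight_def)
qed

lemma slope_inj:
  assumes "p \<in> S" "x \<in> S" "y \<in> S" "d \<bullet> (x - p) > 0" "d \<bullet> (y - p) > 0" "slope d p x = slope d p y"
  shows "x = y"
proof -
  have "orient p x y = 0"
    using orient_pos_iff_slope_less[OF assms(4,5)] orient_neg_iff_slope_less[OF assms(4,5)] assms(6)
    by linarith
  moreover have "x \<noteq> p" "y \<noteq> p" using assms by auto
  ultimately show ?thesis using on_line_imp_eq[of p x y] assms by auto
qed

text \<open>Induction cuts off the triangle of \<open>p\<close> and the two angularly last points
  \<open>w\<close> and \<open>u\<close>. The line \<open>pw\<close> separates it from the hull of
  the remaining points, so the two pieces share only \<open>p\<close> and \<open>w\<close> among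
  points of \<open>S\<close>, and the triangle has no further red point. It is red-empty because
  \<open>X\<close> contains all red points of its hull, a property that survives the removal of
  \<open>u\<close>.\<close>

lemma weight_star:
  assumes "X \<subseteq> R" "p \<in> X" "p \<in> K" "R \<inter> convex hull X \<subseteq> X"
    and "\<And>x. x \<in> X \<Longrightarrow> x \<noteq> p \<Longrightarrow> d \<bullet> (x - p) > 0"
  shows "card X \<le> weight K (convex hull X) + 2"
  using assms
proof (induction "card X" arbitrary: X)
  case 0
  thus ?case by simp
next
  case (Suc n)
  note XR = \<open>X \<subseteq> R\<close> and closed = \<open>R \<inter> convex hull X \<subseteq> X\<close>
  have finX: "finite X" using XR finR finite_subset by blast
  show ?case
  proof (cases "card X \<le> 2")
    case False
    have "card (X - {p}) \<ge> 2" using False Suc.prems finX by (simp add: card_Diff_subset)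
    hence "X - {p} \<noteq> {}" by force
    then obtain u where u: "u \<in> X - {p}" and umax: "\<And>x. x \<in> X - {p} \<Longrightarrow> slope d p x \<le> slope d p u"
      using finite_obtains_max[of "X - {p}" "slope d p"] finX by blast
    have "card (X - {p} - {u}) \<ge> 1" using \<open>card (X - {p}) \<ge> 2\<close> u finX by simp
    hence "X - {p} - {u} \<noteq> {}" by force
    then obtain w where w: "w \<in> X - {p} - {u}"
        and wmax: "\<And>x. x \<in> X - {p} - {u} \<Longrightarrow> slope d p x \<le> slope d p w"
      using finite_obtains_max[of "X - {p} - {u}" "slope d p"] finX by blast
    have dpos: "d \<bullet> (x - p) > 0" if "x \<in> X" "x \<noteq> p" for x using Suc.prems that by blast
    have inS: "p \<in> S" "u \<in> S" "w \<in> S" using u w \<open>p \<in> X\<close> XR RS by auto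
    have wu: "orient p w u > 0"
      using orient_pos_iff_slope_less[of d w p u] umax[of w] slope_inj[OF inS(1,3,2), of d] dpos u w
      by (smt (verit) Diff_iff singletonI)
    have le: "orient p w x \<le> 0" if "x \<in> X - {u}" for x
    proof (cases "x = p")
      case False
      hence "slope d p x \<le> slope d p w" using wmax that by blast
      thus ?thesis using orient_pos_iff_slope_less[of d w p x] dpos[of w] dpos[of x] that w False
        by force
    qed simp
    let ?X' = "X - {u}"
    let ?T = "{p, w, u}"
    have sub': "convex hull ?X' \<subseteq> convex hull X" by (intro hull_mono) auto
    have h1: "convex hull ?X' \<subseteq> {x. orient p w x \<le> 0}"
      using le by (intro hull_minimal convex_orient_le) auto
    have h2: "convex hull ?T \<subseteq> {x. orient p w x \<ge> 0}"
      using wu by (intro hull_minimal convex_orient_ge) auto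
    have subT: "convex hull ?T \<subseteq> convex hull X"
      using u w \<open>p \<in> X\<close> by (intro hull_mono) auto
    have "u \<notin> convex hull ?X'" using h1 wu by auto
    hence closed': "R \<inter> convex hull ?X' \<subseteq> ?X'" using closed sub' by blast
    have meet: "convex hull ?X' \<inter> convex hull ?T \<inter> S \<subseteq> {p, w}"
    proof
      fix x assume x: "x \<in> convex hull ?X' \<inter> convex hull ?T \<inter> S"
      hence "orient p w x = 0" using h1 h2 by force
      thus "x \<in> {p, w}" using on_line_imp_eq[of p w x] x inS w by blast
    qed
    have IH: "card ?X' \<le> weight K (convex hull ?X') + 2"
      using Suc.hyps(2) u finX XR Suc.prems closed' by (intro Suc.hyps(1)) auto
    have "convex hull ?T \<inter> R \<subseteq> ?T"
    proof
      fix x assume x: "x \<in> convex hull ?T \<inter> R"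
      hence "x \<in> X" using closed subT by blast
      show "x \<in> ?T"
      proof (cases "x = u")
        case False
        hence "orient p w x = 0" using le[of x] h2 x \<open>x \<in> X\<close> by force
        thus ?thesis using on_line_imp_eq[of p w x] x inS w RS by blast
      qed simp
    qed
    hence T: "weight K (convex hull ?T) \<ge> 1"
      using u w \<open>p \<in> X\<close> \<open>p \<in> K\<close> XR by (intro weight_pos_if_empty_of_red) (auto simp: card_insert_if)
    \<comment> \<open>There are only two regions here; the empty set stands in for the
      third.\<close>
    have "weight K (convex hull ?X') + weight K (convex hull ?T) + weight K {} \<le> weight K (convex hull X)"
      using sub' subT meet w \<open>p \<in> X\<close> XR by (intro weight_superadditive[of _ _ _ _ p w p p p p]) auto
    moreover have "card X = card ?X' + 1" using u finX card.remove[of X u] by simp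
    ultimately show ?thesis using IH T by linarith
  qed auto
qed

end

section \<open>Nested triangles and the gain inside a triangle\<close>

text \<open>The normal of a line strictly separating \<open>a\<close> from the hull of
  \<open>Y\<close> points from \<open>a\<close> towards every other point of the joint hull. It
  supplies the axis \<open>d\<close> that \<open>slope\<close> needs at an extreme point.\<close>

lemma pointed_hull_direction:
  fixes a :: "real^2"
  assumes "finite Y" "Y \<noteq> {}" "a \<notin> convex hull Y"
  obtains d where "\<And>z. z \<in> convex hull (insert a Y) \<Longrightarrow> z \<noteq> a \<Longrightarrow> d \<bullet> (z - a) > 0"
proof -
  have "closed (convex hull Y)"
    using assms(1) by (simp add: compact_imp_closed finite_imp_compact_convex_hull)
  then obtain d b where d: "d \<bullet> a < b" "\<And>x. x \<in> convex hull Y \<Longrightarrow> d \<bullet> x > b"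
    using separating_hyperplane_closed_point[OF convex_convex_hull _ assms(3)] by blast
  have "d \<bullet> (z - a) > 0" if z: "z \<in> convex hull (insert a Y)" "z \<noteq> a" for z
  proof -
    obtain s t y where st: "s \<ge> 0" "t \<ge> 0" "s + t = 1" "y \<in> convex hull Y" "z = s *\<^sub>R a + t *\<^sub>R y"
      using z(1) unfolding convex_hull_insert[OF assms(2)] by blast
    have s: "s = 1 - t" using st by simp
    have "t \<noteq> 0" using z(2) st by auto
    have "z - a = t *\<^sub>R (y - a)" unfolding st(5) s by (simp add: algebra_simps)
    moreover have "d \<bullet> (y - a) > 0" using d(1) d(2)[OF st(4)] by (simp add: inner_diff_right)
    ultimately show ?thesis using \<open>t \<noteq> 0\<close> st(2) by simp
  qed
  thus ?thesis using that by blast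
qed

context two_colored
begin

lemma weight_star_triangle:
  assumes "{a, x, y} \<subseteq> R" "a \<noteq> x" "a \<noteq> y" "a \<in> K"
  shows "card (R \<inter> convex hull {a, x, y}) \<le> weight K (convex hull {a, x, y}) + 2"
proof -
  let ?X = "R \<inter> convex hull {a, x, y}"
  have "{a, x, y} \<subseteq> ?X" using assms hull_subset[of "{a, x, y}" convex] by auto
  hence hX: "convex hull ?X = convex hull {a, x, y}"
    by (intro subset_antisym hull_mono hull_minimal convex_convex_hull) auto
  have "a \<notin> convex hull {x, y}" using on_segment_imp_eq[of x y a] assms RS by auto
  then obtain d where d: "\<And>z. z \<in> convex hull {a, x, y} \<Longrightarrow> z \<noteq> a \<Longrightarrow> d \<bullet> (z - a) > 0"
    using pointed_hull_direction[of "{x, y}" a] by auto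
  have "card ?X \<le> weight K (convex hull ?X) + 2"
    using \<open>{a, x, y} \<subseteq> ?X\<close> assms d by (intro weight_star[of ?X a K d]) (auto simp: hX)
  thus ?thesis by (simp add: hX)
qed

text \<open>The point \<open>c\<close> cuts the triangle into three. The two pieces other than
  \<open>xyc\<close> have a corner \<open>x\<close> or \<open>y\<close> in \<open>K\<close> and obey
  the star bound there. This costs 2 each, whereas shared vertices are overcounted 5 times, so the
  excess of the weight over the star bound drops by at least 1 from \<open>xyq\<close> to
  \<open>xyc\<close>.\<close>

lemma weight_triangle_split:
  assumes "{x, y, q, c} \<subseteq> R" "card {x, y, q, c} = 4" "x \<in> K" "y \<in> K"
    and c: "c \<in> convex hull {x, y, q}"
  shows "weight K (convex hull {x, y, c}) + card (R \<inter> convex hull {x, y, q}) + 1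
       \<le> weight K (convex hull {x, y, q}) + card (R \<inter> convex hull {x, y, c})"
proof -
  have ne: "x \<noteq> y" "x \<noteq> q" "x \<noteq> c" "y \<noteq> q" "y \<noteq> c" "q \<noteq> c"
    using assms(2) by (auto simp: card_insert_if split: if_splits)
  have inS: "x \<in> S" "y \<in> S" "q \<in> S" "c \<in> S" using assms(1) RS by auto
  let ?A = "convex hull {x, y, q}"
  let ?A1 = "convex hull {x, y, c}" and ?A2 = "convex hull {x, c, q}" and ?A3 = "convex hull {y, c, q}"
  have sub: "?A1 \<subseteq> ?A" "?A2 \<subseteq> ?A" "?A3 \<subseteq> ?A"
    using c by (intro hull_minimal convex_convex_hull; simp add: hull_inc)+
  have indep: "\<not> affine_dependent {x, y, q}"
    using not_collinear[of x y q] inS ne by (auto simp: collinear_3_eq_affine_dependent)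
  \<comment> \<open>Two pieces meet in the segment from \<open>c\<close> to their common vertex; by
    general position only its ends are in \<open>S\<close>.\<close>
  have meet: "convex hull (insert c T) \<inter> convex hull (insert c T') \<inter> S \<subseteq> {c, a}"
    if "T \<subseteq> {x, y, q}" "T' \<subseteq> {x, y, q}" "T \<inter> T' = {a}" for T T' a
  proof
    fix z assume z: "z \<in> convex hull (insert c T) \<inter> convex hull (insert c T') \<inter> S"
    hence "z \<in> convex hull {c, a}"
      using convex_hull_exchange_Int[OF indep c that(1,2)] that(3) by auto
    moreover have "a \<in> S" using that inS by blast
    ultimately show "z \<in> {c, a}" using on_segment_imp_eq[of c a z] inS z by blast
  qed
  have "weight K ?A1 + weight K ?A2 + weight K ?A3 \<le> weight K ?A"
  proof (rule weight_superadditive)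
    show "?A1 \<inter> ?A2 \<inter> S \<subseteq> {c, x}"
      using meet[of "{x, y}" "{x, q}" x] ne by (auto simp: insert_commute)
    show "?A1 \<inter> ?A3 \<inter> S \<subseteq> {c, y}"
      using meet[of "{x, y}" "{y, q}" y] ne by (auto simp: insert_commute)
    show "?A2 \<inter> ?A3 \<inter> S \<subseteq> {c, q}"
      using meet[of "{x, q}" "{y, q}" q] ne by (auto simp: insert_commute)
  qed (use sub assms(1) in auto)
  moreover have "card (R \<inter> ?A2) \<le> weight K ?A2 + 2"
    using assms ne by (intro weight_star_triangle) auto
  moreover have "card (R \<inter> ?A3) \<le> weight K ?A3 + 2"
    using assms ne by (intro weight_star_triangle) auto
  \<comment> \<open>The vertices \<open>x\<close>, \<open>y\<close>, \<open>q\<close> lie in two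
    pieces each and \<open>c\<close> in all three: 9 incidences for 4 points.\<close>
  moreover have "card (R \<inter> ?A) + 5 \<le> card (R \<inter> ?A1) + card (R \<inter> ?A2) + card (R \<inter> ?A3)"
  proof -
    let ?V = "{x, y, q, c}"
    have cov: "?A \<subseteq> ?A1 \<union> ?A2 \<union> ?A3"
    proof
      fix z assume "z \<in> ?A"
      then obtain b where "b \<in> {x, y, q}" "z \<in> convex hull (insert c ({x, y, q} - {b}))"
        using in_convex_hull_exchange[OF c] by blast
      moreover have "{x, y, q} - {x} = {y, q}" "{x, y, q} - {y} = {x, q}" "{x, y, q} - {q} = {x, y}"
        using ne by auto
      ultimately have "z \<in> convex hull {c, y, q} \<or> z \<in> convex hull {c, x, q} \<or> z \<in> convex hull {c, x, y}"
        by (metis insertE singletonD)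
      moreover have "{c, y, q} = {y, c, q}" "{c, x, q} = {x, c, q}" "{c, x, y} = {x, y, c}" by auto
      ultimately show "z \<in> ?A1 \<union> ?A2 \<union> ?A3" by (metis UnCI)
    qed
    have V: "?V \<subseteq> R \<inter> ?A" using assms(1) c hull_subset[of "{x, y, q}" convex] by auto
    have c1: "card (R \<inter> ?A - ?V) = card (R \<inter> ?A) - card ?V"
      by (intro card_Diff_subset V) simp
    have c2: "card ?V \<le> card (R \<inter> ?A)"
      by (intro card_mono V) (simp add: finR)
    have part: "card (R \<inter> convex hull W - ?V) + 3 \<le> card (R \<inter> convex hull W)"
      if "W \<subseteq> ?V" "card W = 3" for W
    proof -
      have fW: "finite W" using that finite_subset by blast
      have "card (R \<inter> convex hull W - ?V) + card W = card ((R \<inter> convex hull W - ?V) \<union> W)"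
        using that fW finR by (subst card_Un_disjoint) auto
      also have "\<dots> \<le> card (R \<inter> convex hull W)"
        using that finR assms(1) hull_subset[of W convex] by (intro card_mono) auto
      finally show ?thesis using that by simp
    qed
    have "card (R \<inter> ?A - ?V) \<le> card ((R \<inter> ?A1 - ?V) \<union> (R \<inter> ?A2 - ?V) \<union> (R \<inter> ?A3 - ?V))"
      using cov finR by (intro card_mono) auto
    also have "\<dots> \<le> card (R \<inter> ?A1 - ?V) + card (R \<inter> ?A2 - ?V) + card (R \<inter> ?A3 - ?V)"
      by (meson card_Un_le order_trans add_right_mono)
    finally have "card (R \<inter> ?A - ?V) \<le> card (R \<inter> ?A1 - ?V) + card (R \<inter> ?A2 - ?V) + card (R \<inter> ?A3 - ?V)" .
    moreover have "card (R \<inter> ?A1 - ?V) + 3 \<le> card (R \<inter> ?A1)" using ne by (intro part) auto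
    moreover have "card (R \<inter> ?A2 - ?V) + 3 \<le> card (R \<inter> ?A2)" using ne by (intro part) auto
    moreover have "card (R \<inter> ?A3 - ?V) + 3 \<le> card (R \<inter> ?A3)" using ne by (intro part) auto
    ultimately show ?thesis using assms(2) c1 c2 by linarith
  qed
  ultimately show ?thesis by linarith
qed

text \<open>The excess of the weight over the star bound strictly increases along nested triangles; the
  excesses over \<open>pu\<close> and \<open>uv\<close> serve as Erdos-Szekeres labels.\<close>

lemma weight_triangle_gain:
  assumes T: "{p, u, v} \<subseteq> R" "p \<noteq> u" "p \<noteq> v" "u \<noteq> v" and K: "{p, u, v} \<subseteq> K"
  defines "D \<equiv> convex hull {p, u, v}"
  shows "card (R \<inter> D) \<le> (weight K D + 2 - card (R \<inter> D))\<^sup>2 + 3"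
proof -
  define N where "N = weight K D + 2 - card (R \<inter> D)"
  define M where "M = R \<inter> D - {p, u, v}"
  \<comment> \<open>The label is one more than the excess, so it is at least 1 by the star bound,
    which also rules out truncated subtraction. It is at most \<open>N\<close> because the excess
    grows strictly on passing to the whole triangle.\<close>
  define g where "g x y q = weight K (convex hull {x, y, q}) + 3 - card (R \<inter> convex hull {x, y, q})" for x y q
  have inS: "p \<in> S" "u \<in> S" "v \<in> S" using T RS by auto
  have star: "card (R \<inter> convex hull {x, y, q}) \<le> weight K (convex hull {x, y, q}) + 2"
    if "{x, y, q} \<subseteq> R" "x \<noteq> y" "x \<noteq> q" "x \<in> K" for x y q
    using weight_star_triangle that by blast
  have bound: "g p u q \<in> {1..N}" "g u v q \<in> {1..N}" if "q \<in> M" for q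
  proof -
    have q: "q \<in> R" "q \<in> D" "q \<noteq> p" "q \<noteq> u" "q \<noteq> v" using that by (auto simp: M_def)
    have D': "D = convex hull {u, v, p}" by (simp add: D_def insert_commute)
    show "g p u q \<in> {1..N}"
      using weight_triangle_split[of p u v q K] q T K star[of p u q] star[of p u v]
      unfolding g_def N_def D_def by auto
    show "g u v q \<in> {1..N}"
      using weight_triangle_split[of u v p q K] q T K star[of u v q] star[of u v p]
      unfolding g_def N_def D' by auto
  qed
  have less: "g x y c < g x y q"
    if "c \<in> convex hull {x, y, q}" "c \<in> M" "q \<in> M" "c \<noteq> q" "x \<noteq> y" "{x, y} \<subseteq> {p, u, v}" for x y c q
  proof -
    have *: "{x, y, q, c} \<subseteq> R" "card {x, y, q, c} = 4" "x \<in> K" "y \<in> K" "x \<noteq> q" "x \<noteq> c"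
      using that T K by (auto simp: M_def card_insert_if)
    have "card (R \<inter> convex hull {x, y, q}) \<le> weight K (convex hull {x, y, q}) + 2"
         "card (R \<inter> convex hull {x, y, c}) \<le> weight K (convex hull {x, y, c}) + 2"
      using * that(5) by (intro star; simp)+
    thus ?thesis
      using weight_triangle_split[OF *(1-4) that(1)] unfolding g_def by linarith
  qed
  \<comment> \<open>By general position no further point of \<open>S\<close> lies on a side, so all
    three coordinates are strictly positive.\<close>
  have coords: "\<exists>x y z. q = x *\<^sub>R p + y *\<^sub>R u + z *\<^sub>R v \<and> x > 0 \<and> y > 0 \<and> z > 0 \<and> x + y + z = 1"
    if qM: "q \<in> M" for q
  proof -
    obtain x y z where xyz: "q = x *\<^sub>R p + y *\<^sub>R u + z *\<^sub>R v" "x \<ge> 0" "y \<ge> 0" "z \<ge> 0" "x + y + z = 1"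
      using qM unfolding M_def D_def convex_hull_3 by blast
    have q: "q \<in> S" "q \<notin> {p, u, v}" using qM RS by (auto simp: M_def)
    have "x \<noteq> 0"
    proof
      assume "x = 0"
      hence "q \<in> convex hull {u, v}" unfolding convex_hull_2 using xyz by force
      thus False using on_segment_imp_eq[of u v q] q inS by blast
    qed
    moreover have "y \<noteq> 0"
    proof
      assume "y = 0"
      hence "q \<in> convex hull {p, v}" unfolding convex_hull_2 using xyz by force
      thus False using on_segment_imp_eq[of p v q] q inS by blast
    qed
    moreover have "z \<noteq> 0"
    proof
      assume "z = 0"
      hence "q \<in> convex hull {p, u}" unfolding convex_hull_2 using xyz by force
      thus False using on_segment_imp_eq[of p u q] q inS by blast
    qed
    ultimately show ?thesis using xyz by (smt (verit, best))
  qed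
  \<comment> \<open>Any two interior points are nested over \<open>pu\<close> or over
    \<open>uv\<close>, and the label for that side tells them apart. Hence there are at most
    \<open>N\<close> squared of them.\<close>
  have "inj_on (\<lambda>q. (g p u q, g u v q)) M"
  proof (rule inj_onI, rule ccontr)
    fix c q assume cq: "c \<in> M" "q \<in> M" "c \<noteq> q" and eq: "(g p u c, g u v c) = (g p u q, g u v q)"
    have "c \<in> convex hull {p, u, q} \<or> q \<in> convex hull {p, u, c} \<or>
          c \<in> convex hull {u, v, q} \<or> q \<in> convex hull {u, v, c}"
      using coords[OF cq(1)] coords[OF cq(2)] triangle_points_comparable by blast
    thus False
      using eq cq T(2,4) less[of c p u q] less[of q p u c] less[of c u v q] less[of q u v c] by auto
  qed
  hence "card M \<le> card ({1..N} \<times> {1..N})"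
    using bound by (intro card_inj_on_le[where f = "\<lambda>q. (g p u q, g u v q)"]) auto
  hence "card M \<le> N\<^sup>2" by (simp add: power2_eq_square)
  moreover have "card (R \<inter> D) = card M + 3"
  proof -
    have "{p, u, v} \<subseteq> R \<inter> D" using T hull_subset[of "{p, u, v}" convex] by (auto simp: D_def)
    moreover have "card {p, u, v} = 3" using T by auto
    ultimately show ?thesis
      using finR card_mono[of "R \<inter> D" "{p, u, v}"] by (simp add: M_def card_Diff_subset)
  qed
  ultimately show ?thesis by (simp add: N_def)
qed

end

section \<open>Extreme points and the fan triangulation\<close>

lemma extreme_point_notin_hull_remove:
  assumes "x extreme_point_of (convex hull X)"
  shows "x \<notin> convex hull (X - {x})"
proof -
  have "convex (convex hull X - {x})"
    using assms extreme_point_of_stillconvex by blast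
  hence "convex hull (X - {x}) \<subseteq> convex hull X - {x}"
    using hull_subset[of X convex] by (intro hull_minimal) auto
  thus ?thesis by blast
qed

lemma convex_remove_extreme_points:
  assumes "convex C" "\<And>x. x \<in> H \<Longrightarrow> x extreme_point_of C"
  shows "convex (C - H)"
  unfolding convex_contains_open_segment
proof (intro ballI subsetI)
  fix a b x assume "a \<in> C - H" "b \<in> C - H" "x \<in> open_segment a b"
  moreover have "open_segment a b \<subseteq> C"
    using \<open>convex C\<close> calculation convex_contains_open_segment by blast
  ultimately show "x \<in> C - H"
    using assms(2) by (auto simp: extreme_point_of_def)
qed

context two_colored
begin

text \<open>The fan at \<open>p\<close> distributes the non-extreme points over at most
  \<open>card H\<close> triangles, and \<open>puv\<close> is a fullest one. The red points angularly
  before and after it obey the star bound at \<open>p\<close>, while \<open>puv\<close> itself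
  exceeds that bound by \<open>N\<close>. By \<open>weight_triangle_gain\<close> its interior has at
  most \<open>N\<close> squared red points.\<close>

lemma fan_gain:
  assumes XR: "X \<subseteq> R" and closed: "R \<inter> convex hull X \<subseteq> X"
  defines "H \<equiv> {x. x extreme_point_of (convex hull X)}"
  assumes big: "card H < card X"
  obtains p u v N where "{p, u, v} \<subseteq> H"
    and "card X + N \<le> weight {p, u, v} (convex hull X) + 2"
    and "card X \<le> card H + card H * N\<^sup>2"
proof -
  have finX: "finite X" using XR finR finite_subset by blast
  have HX: "H \<subseteq> X" using extreme_point_of_convex_hull by (auto simp: H_def)
  have finH: "finite H" using HX finX finite_subset by blast
  have hullH: "convex hull H = convex hull X"
    using Krein_Milman_polytope[OF finX] by (simp add: H_def)
  have notin: "x \<notin> convex hull (X - {x})" if "x \<in> H" for x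
    using extreme_point_notin_hull_remove that by (auto simp: H_def)
  have "X \<noteq> {}" using big by auto
  hence "H \<noteq> {}" using hullH by (metis convex_hull_eq_empty)
  then obtain p where p: "p \<in> H" by blast
  have "card H \<ge> 1" using p finH by (metis One_nat_def Suc_leI card_gt_0_iff empty_iff)
  hence "X \<noteq> {p}" using big by auto
  hence "X - {p} \<noteq> {}" using p HX by blast
  then obtain d where d: "\<And>z. z \<in> convex hull (insert p (X - {p})) \<Longrightarrow> z \<noteq> p \<Longrightarrow> d \<bullet> (z - p) > 0"
    using pointed_hull_direction[of "X - {p}" p] finX notin[OF p] by blast
  have pX: "p \<in> X" using p HX by blast
  hence "insert p (X - {p}) = X" by blast
  hence dpos: "d \<bullet> (z - p) > 0" if "z \<in> X" "z \<noteq> p" for z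
    using d[of z] that hull_subset[of X convex] by auto
  define s where "s = slope d p"
  have XS: "x \<in> S" if "x \<in> X" for x using that XR RS by blast
  have pos: "orient p x y > 0 \<longleftrightarrow> s x < s y" and neg: "orient p x y < 0 \<longleftrightarrow> s y < s x"
    if "x \<in> X - {p}" "y \<in> X - {p}" for x y
    using orient_pos_iff_slope_less[of d x p y] orient_neg_iff_slope_less[of d x p y] dpos that
    by (auto simp: s_def)
  have s_inj: "x = y" if "x \<in> X - {p}" "y \<in> X - {p}" "s x = s y" for x y
    using slope_inj[of p x y d] dpos XS pX that by (auto simp: s_def)

  \<comment> \<open>Were all other extreme points strictly on one side of the line
    \<open>pq\<close>, the hull would touch that line in \<open>p\<close> only. Both orientations of
    the line are used, giving extreme points angularly before and after \<open>q\<close>.\<close>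
  have not_one_side: "\<exists>h\<in>H - {p}. \<not> orient a b h > 0"
    if q: "q \<in> X - H" and ab: "orient a b p = 0" "orient a b q = 0" for a b q
  proof (rule ccontr)
    assume "\<not> ?thesis"
    hence "convex hull (H - {p}) \<subseteq> {x. orient a b x > 0}"
      by (intro hull_minimal convex_orient_gt) auto
    moreover have qH: "q \<in> convex hull (insert p (H - {p}))"
      using q p hullH hull_subset[of X convex] by (auto simp: insert_absorb)
    moreover have "q \<noteq> p" using q p by blast
    moreover have "H - {p} \<noteq> {}"
    proof
      assume "H - {p} = {}"
      with qH have "q \<in> convex hull {p}" by simp
      thus False using \<open>q \<noteq> p\<close> by simp
    qed
    ultimately obtain g t y where gt: "g \<ge> 0" "t \<ge> 0" "g + t = 1" "orient a b y > 0" "q = g *\<^sub>R p + t *\<^sub>R y"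
      unfolding convex_hull_insert[OF \<open>H - {p} \<noteq> {}\<close>] by blast
    have "t \<noteq> 0" using gt \<open>q \<noteq> p\<close> by auto
    have "orient a b q = t * orient a b y" using orient_affine[OF gt(3), of a b p y] gt(5) ab by simp
    thus False using ab gt \<open>t \<noteq> 0\<close> by simp
  qed
  have lo: "{h \<in> H - {p}. s h < s q} \<noteq> {}" and hi: "{h \<in> H - {p}. s q < s h} \<noteq> {}" if qM: "q \<in> X - H" for q
  proof -
    have q: "q \<in> X - {p}" using qM p by blast
    obtain h where h: "h \<in> H - {p}" "\<not> orient p q h > 0"
      using not_one_side[OF qM, of p q] by auto
    hence "s h \<le> s q" "h \<noteq> q" using pos[OF q, of h] HX qM by auto
    hence "s h < s q" using s_inj[OF q, of h] h HX by fastforce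
    thus "{h \<in> H - {p}. s h < s q} \<noteq> {}" using h by blast
    obtain h where h: "h \<in> H - {p}" "\<not> orient q p h > 0"
      using not_one_side[OF qM, of q p] by (auto simp: orient_def)
    hence "\<not> orient p q h < 0" by (simp add: orient_def algebra_simps)
    hence "s q \<le> s h" "h \<noteq> q" using neg[OF q, of h] HX qM h by auto
    hence "s q < s h" using s_inj[OF q, of h] h HX by fastforce
    thus "{h \<in> H - {p}. s q < s h} \<noteq> {}" using h by blast
  qed
  \<comment> \<open>The last extreme point before \<open>q\<close> names the fan triangle of
    \<open>q\<close>, so the sets \<open>F h\<close> below are the contents of the fan
    triangles.\<close>
  have "\<exists>h. h \<in> H - {p} \<and> s h < s q \<and> (\<forall>x\<in>H - {p}. s x < s q \<longrightarrow> s x \<le> s h)" if qM: "q \<in> X - H" for q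
  proof -
    obtain h where "h \<in> {h \<in> H - {p}. s h < s q}" "\<And>x. x \<in> {h \<in> H - {p}. s h < s q} \<Longrightarrow> s x \<le> s h"
      using finite_obtains_max[OF _ lo[OF qM], of s] finH by auto
    thus ?thesis by blast
  qed
  then obtain U where U: "\<And>q. q \<in> X - H \<Longrightarrow> U q \<in> H - {p}" "\<And>q. q \<in> X - H \<Longrightarrow> s (U q) < s q"
      "\<And>q x. q \<in> X - H \<Longrightarrow> x \<in> H - {p} \<Longrightarrow> s x < s q \<Longrightarrow> s x \<le> s (U q)"
    by metis
  define F where "F h = {q \<in> X - H. U q = h}" for h
  obtain u where u: "u \<in> H" and umax: "\<And>h. h \<in> H \<Longrightarrow> real (card (F h)) \<le> real (card (F u))"
    using finite_obtains_max[OF finH \<open>H \<noteq> {}\<close>, of "\<lambda>h. real (card (F h))"] by blast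
  have cardM: "card (X - H) \<le> card H * card (F u)"
  proof -
    have "card (X - H) \<le> card (\<Union>h\<in>H. F h)"
      using U finX finH by (intro card_mono finite_UN_I) (auto simp: F_def)
    also have "\<dots> \<le> (\<Sum>h\<in>H. card (F h))" using finH by (intro card_UN_le)
    also have "\<dots> \<le> card H * card (F u)" using umax sum_bounded_above[of H "\<lambda>h. card (F h)" "card (F u)"] by auto
    finally show ?thesis .
  qed
  have cXH: "card (X - H) = card X - card H" using finH HX by (simp add: card_Diff_subset)
  \<comment> \<open>A point in the fullest triangle excludes \<open>u = p\<close> and guarantees an
    extreme point after \<open>u\<close>; the first such one is \<open>v\<close>.\<close>
  hence "F u \<noteq> {}" using cardM big by auto
  then obtain q0 where q0: "q0 \<in> X - H" "U q0 = u" by (auto simp: F_def)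
  have up: "u \<noteq> p" using U(1)[OF q0(1)] q0 by auto
  have "{h \<in> H - {p}. s u < s h} \<noteq> {}" using hi[OF q0(1)] U(2)[OF q0(1)] q0(2) by fastforce
  then obtain v where v: "v \<in> {h \<in> H - {p}. s u < s h}"
      and vmin: "\<And>x. x \<in> {h \<in> H - {p}. s u < s h} \<Longrightarrow> - s x \<le> - s v"
    using finite_obtains_max[of "{h \<in> H - {p}. s u < s h}" "\<lambda>x. - s x"] finH by auto
  have uX: "u \<in> X - {p}" and vX: "v \<in> X - {p}" using u v up HX by auto
  have uv: "s u < s v" using v by simp
  have puv: "orient p u v > 0" using pos[OF uX vX] uv by simp
  let ?D = "convex hull {p, u, v}"
  let ?K = "{p, u, v}"
  have DX: "?D \<subseteq> convex hull X" using pX uX vX by (intro hull_mono) auto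

  \<comment> \<open>A point of the sector outside the triangle lies beyond the line
    \<open>uv\<close>, hence so does some extreme point \<open>e\<close>. No extreme point is
    angularly between \<open>u\<close> and \<open>v\<close>, so \<open>e\<close> comes after
    \<open>v\<close> or before \<open>u\<close>. Then \<open>v\<close> is in the triangle
    \<open>pue\<close>, or \<open>u\<close> is in \<open>pev\<close>, against extremality.\<close>
  have inD: "q \<in> ?D" if q: "q \<in> X - {p}" "s u < s q" "s q < s v" for q
  proof (rule ccontr)
    assume "q \<notin> ?D"
    moreover have "orient p u q > 0" using pos[OF uX q(1)] q by simp
    moreover have "orient v p q > 0"
      using pos[OF q(1) vX] q orient_rotate[of v p q] by simp
    ultimately have "orient u v q < 0"
      using in_triangle_if_orient_nonneg[OF puv, of q] by linarith
    have "\<exists>e\<in>H. orient u v e < 0"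
    proof (rule ccontr)
      assume "\<not> ?thesis"
      hence "convex hull H \<subseteq> {x. orient u v x \<ge> 0}"
        by (intro hull_minimal convex_orient_ge) force
      moreover have "q \<in> convex hull H" using q hullH hull_subset[of X convex] by auto
      ultimately show False using \<open>orient u v q < 0\<close> by force
    qed
    then obtain e where e: "e \<in> H" "orient u v e < 0" by blast
    have "orient u v p > 0" using puv orient_rotate[of p u v] by simp
    hence ne: "e \<noteq> p" "e \<noteq> u" "e \<noteq> v" using e orient_degenerate by auto
    have eX: "e \<in> X - {p}" using e ne HX by blast
    consider "s v < s e" | "s e < s u"
      using vmin[of e] s_inj[OF uX eX] s_inj[OF vX eX] e ne by fastforce
    thus False
    proof cases
      case 1
      have "orient p v e > 0" using pos[OF vX eX] 1 by simp
      moreover have "orient p u e > 0" using pos[OF uX eX] 1 uv by simp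
      moreover have "orient e p v = orient p v e" by (rule orient_rotate)
      moreover have "orient u e v = - orient u v e" by (rule orient_swap)
      ultimately have "v \<in> convex hull {p, u, e}"
        using puv e by (intro in_triangle_if_orient_nonneg) auto
      also have "\<dots> \<subseteq> convex hull (X - {v})"
        using pX uX vX eX ne uv by (intro hull_mono) auto
      finally show False using notin v by blast
    next
      case 2
      have "orient p e u > 0" using pos[OF eX uX] 2 by simp
      moreover have "orient p e v > 0" using pos[OF eX vX] 2 uv by simp
      moreover have "orient v p u = orient p u v" by (rule orient_rotate)
      moreover have "orient e v u = - orient u v e"
        using orient_rotate[of e v u] orient_rotate[of v u e] orient_swap[of u e v] by simp
      ultimately have "u \<in> convex hull {p, e, v}"
        using puv e by (intro in_triangle_if_orient_nonneg) auto
      also have "\<dots> \<subseteq> convex hull (X - {u})"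
        using pX uX vX eX ne uv by (intro hull_mono) auto
      finally show False using notin u by blast
    qed
  qed

  define X1 where "X1 = {x \<in> X. x = p \<or> s x \<le> s u}"
  define X2 where "X2 = {x \<in> X. x = p \<or> s v \<le> s x}"
  have sub1: "convex hull X1 \<subseteq> convex hull X" and sub2: "convex hull X2 \<subseteq> convex hull X"
    by (intro hull_mono; auto simp: X1_def X2_def)+
  have le1: "orient p u x \<le> 0" "orient p v x \<le> 0" if "x \<in> X1" for x
    using that pos[OF uX, of x] pos[OF vX, of x] uv by (cases "x = p"; force simp: X1_def)+
  have ge2: "orient p v x \<ge> 0" if "x \<in> X2" for x
    using that neg[OF vX, of x] by (cases "x = p"; force simp: X2_def)
  have h1: "convex hull X1 \<subseteq> {x. orient p u x \<le> 0}" "convex hull X1 \<subseteq> {x. orient p v x \<le> 0}"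
    using le1 by (intro hull_minimal convex_orient_le; blast)+
  have h2: "convex hull X2 \<subseteq> {x. orient p v x \<ge> 0}"
    using ge2 by (intro hull_minimal convex_orient_ge) blast
  have hD: "?D \<subseteq> {x. orient p u x \<ge> 0}" "?D \<subseteq> {x. orient p v x \<le> 0}"
    using puv orient_swap[of p u v]
    by (intro hull_minimal convex_orient_ge convex_orient_le; auto)+
  have closed1: "R \<inter> convex hull X1 \<subseteq> X1"
  proof
    fix x assume x: "x \<in> R \<inter> convex hull X1"
    hence "x \<in> X" "orient p u x \<le> 0" using closed sub1 h1 by auto
    thus "x \<in> X1" using pos[OF uX, of x] by (force simp: X1_def)
  qed
  have closed2: "R \<inter> convex hull X2 \<subseteq> X2"
  proof
    fix x assume x: "x \<in> R \<inter> convex hull X2"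
    hence "x \<in> X" "orient p v x \<ge> 0" using closed sub2 h2 by auto
    thus "x \<in> X2" using neg[OF vX, of x] by (force simp: X2_def)
  qed
  have on_line: "x \<in> {p, w}" if "w \<in> X - {p}" "x \<in> S" "orient p w x = 0" for x w
    using on_line_imp_eq[of p w x] that XS pX by auto
  have sup: "weight ?K (convex hull X1) + weight ?K ?D + weight ?K (convex hull X2) \<le> weight ?K (convex hull X)"
  proof (rule weight_superadditive)
    show "convex hull X1 \<inter> ?D \<inter> S \<subseteq> {p, u}"
      using h1 hD on_line[OF uX] by force
    show "convex hull X1 \<inter> convex hull X2 \<inter> S \<subseteq> {p, v}"
      using h1 h2 on_line[OF vX] by force
    show "?D \<inter> convex hull X2 \<inter> S \<subseteq> {p, v}"
      using h2 hD on_line[OF vX] by force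
  qed (use sub1 sub2 DX pX uX vX XR in auto)
  have star1: "card X1 \<le> weight ?K (convex hull X1) + 2"
    using closed1 XR dpos pX by (intro weight_star[of X1 p ?K d]) (auto simp: X1_def)
  have star2: "card X2 \<le> weight ?K (convex hull X2) + 2"
    using closed2 XR dpos pX by (intro weight_star[of X2 p ?K d]) (auto simp: X2_def)
  define N where "N = weight ?K ?D + 2 - card (R \<inter> ?D)"
  have KR: "?K \<subseteq> R" and ne: "p \<noteq> u" "p \<noteq> v" "u \<noteq> v" using pX uX vX XR uv by auto
  have starD: "card (R \<inter> ?D) \<le> weight ?K ?D + 2"
    using KR ne by (intro weight_star_triangle) auto
  have gain: "card (R \<inter> ?D) \<le> N\<^sup>2 + 3"
    unfolding N_def using KR ne by (intro weight_triangle_gain) auto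
  have KD: "?K \<subseteq> R \<inter> ?D" using KR hull_subset[of ?K convex] by auto
  have cD: "card (R \<inter> ?D - ?K) + 3 = card (R \<inter> ?D)"
  proof -
    have "card ?K = 3" using ne by auto
    thus ?thesis
      using card_Diff_subset[OF _ KD] card_mono[OF _ KD] finR by simp
  qed
  \<comment> \<open>\<open>p\<close> is counted three times, \<open>u\<close> and \<open>v\<close>
    twice. Against three star bounds losing 2 each, a loss of 2 remains.\<close>
  have "card X + 4 \<le> card X1 + card X2 + card (R \<inter> ?D)"
  proof -
    have fin12: "finite X1" "finite X2" using finX by (auto simp: X1_def X2_def)
    have "X \<subseteq> insert p ((X1 - {p}) \<union> (X2 - {p}) \<union> (R \<inter> ?D - ?K))"
    proof
      fix x assume "x \<in> X"
      thus "x \<in> insert p ((X1 - {p}) \<union> (X2 - {p}) \<union> (R \<inter> ?D - ?K))"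
        using inD[of x] XR by (auto simp: X1_def X2_def)
    qed
    hence "card X \<le> card (insert p ((X1 - {p}) \<union> (X2 - {p}) \<union> (R \<inter> ?D - ?K)))"
      using fin12 finR by (intro card_mono) auto
    also have "\<dots> \<le> Suc (card ((X1 - {p}) \<union> (X2 - {p}) \<union> (R \<inter> ?D - ?K)))"
      by (rule card_insert_le_m1[THEN le_trans]) auto
    also have "card ((X1 - {p}) \<union> (X2 - {p}) \<union> (R \<inter> ?D - ?K)) \<le> card (X1 - {p}) + card (X2 - {p}) + card (R \<inter> ?D - ?K)"
      by (meson card_Un_le order_trans add_right_mono)
    finally have "card X \<le> Suc (card (X1 - {p}) + card (X2 - {p}) + card (R \<inter> ?D - ?K))" by simp
    moreover have "card X1 = card (X1 - {p}) + 1" "card X2 = card (X2 - {p}) + 1"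
      using card.remove[OF fin12(1), of p] card.remove[OF fin12(2), of p] pX by (simp_all add: X1_def X2_def)
    ultimately show ?thesis using cD by linarith
  qed
  hence "card X + N \<le> weight ?K (convex hull X) + 2"
    using sup star1 star2 starD unfolding N_def by linarith
  moreover have "card X \<le> card H + card H * N\<^sup>2"
  proof -
    have "F u \<subseteq> R \<inter> ?D - ?K"
    proof
      fix q assume "q \<in> F u"
      hence q: "q \<in> X - H" "U q = u" by (auto simp: F_def)
      hence qX: "q \<in> X - {p}" using p by blast
      have "s u < s q" using U(2) q by blast
      moreover have "s q < s v"
      proof (rule ccontr)
        assume "\<not> s q < s v"
        moreover have "s q \<noteq> s v" using s_inj[OF qX vX] q v by blast
        ultimately have "s v \<le> s u" using U(3)[of q v] q v by auto
        thus False using uv by simp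
      qed
      ultimately show "q \<in> R \<inter> ?D - ?K" using inD[OF qX] q XR p u v by blast
    qed
    hence "card (F u) \<le> card (R \<inter> ?D - ?K)" using finR by (intro card_mono) auto
    hence "card (F u) \<le> N\<^sup>2" using cD gain by linarith
    hence "card H * card (F u) \<le> card H * N\<^sup>2" by simp
    thus ?thesis using cardM cXH big by linarith
  qed
  moreover have "?K \<subseteq> H" using p u v by blast
  ultimately show ?thesis using that by blast
qed


section \<open>Deleting red extreme points under balance\<close>

lemma balanced_imp_busy_extreme_point:
  assumes XR: "X \<subseteq> R" and closed: "R \<inter> convex hull X \<subseteq> X"
    and big: "4 * card X > card S"
    and balanced: "\<And>C. convex C \<Longrightarrow> real (card (S \<inter> C)) \<ge> real (card S) / 8 \<Longrightarrow>
      discrepancy R B (S \<inter> C) < root 3 (real (card S)) / 64"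
  obtains x where "x \<in> X" "x \<notin> convex hull (X - {x})"
    "3 * real (card (triangles_at {x} (convex hull X))) \<ge> root 3 (real (card S))"
proof -
  define k where "k = root 3 (real (card S))"
  define H where "H = {x. x extreme_point_of (convex hull X)}"
  define b where "b = card (convex hull X \<inter> B)"
  have finX: "finite X" using XR finR finite_subset by blast
  have HX: "H \<subseteq> X" using extreme_point_of_convex_hull by (auto simp: H_def)
  have finH: "finite H" using HX finX finite_subset by blast
  have redX: "S \<inter> convex hull X \<inter> R = X"
    using closed XR RS hull_subset[of X convex] by auto
  have blueX: "S \<inter> convex hull X \<inter> B = convex hull X \<inter> B" using BS by blast
  have cX: "real (card X) > real (card S) / 4" using big by linarith
  have "X \<noteq> {}" using big by auto
  hence "card S \<ge> 1" using XR RS fin by (metis One_nat_def Suc_leI card_gt_0_iff subset_empty subset_trans)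
  hence "real (card S) \<ge> 1" by simp
  have k3: "k ^ 3 = real (card S)" by (simp add: k_def)
  have k1: "k \<ge> 1" using \<open>real (card S) \<ge> 1\<close> by (simp add: k_def)
  have kn: "k \<le> real (card S)"
    using self_le_power[of k 3] k1 k3 by simp
  have bal1: "\<bar>real (card X) - real b\<bar> < k / 64"
  proof -
    have "X \<subseteq> S \<inter> convex hull X" using redX by blast
    hence "card X \<le> card (S \<inter> convex hull X)" using fin by (intro card_mono) auto
    hence "real (card (S \<inter> convex hull X)) \<ge> real (card S) / 8" using cX by linarith
    thus ?thesis using balanced[OF convex_convex_hull, of X] redX blueX
      by (simp add: discrepancy_def b_def k_def)
  qed
  \<comment> \<open>Dropping the extreme points loses \<open>card H\<close> red and no blue points.
    Both sets being balanced, \<open>card H\<close> is below twice the allowed discrepancy. The blue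
    points alone make the smaller set large enough.\<close>
  have bal2: "\<bar>real (card X) - real (card H) - real b\<bar> < k / 64"
  proof -
    let ?C = "convex hull X - H"
    have "convex ?C" by (intro convex_remove_extreme_points) (auto simp: H_def)
    have r: "S \<inter> ?C \<inter> R = X - H" using redX by blast
    have bl: "S \<inter> ?C \<inter> B = convex hull X \<inter> B" using blueX HX XR disj by blast
    have "real b > real (card X) - k / 64" using bal1 by linarith
    hence "real b \<ge> real (card S) / 8" using cX kn \<open>real (card S) \<ge> 1\<close> by linarith
    moreover have "b \<le> card (S \<inter> ?C)"
      unfolding b_def using fin bl by (intro card_mono) blast+
    ultimately have "real (card (S \<inter> ?C)) \<ge> real (card S) / 8" by linarith
    hence "discrepancy R B (S \<inter> ?C) < k / 64" using balanced[OF \<open>convex ?C\<close>] by (simp add: k_def)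
    moreover have "real (card (X - H)) = real (card X) - real (card H)"
      using card_Diff_subset[OF finH HX] card_mono[OF finX HX] by simp
    ultimately show ?thesis unfolding discrepancy_def r bl b_def by simp
  qed
  have hk: "real (card H) < k / 32" using bal1 bal2 by linarith
  have "card H \<noteq> 0"
  proof
    assume "card H = 0"
    hence "H = {}" using finH by simp
    hence "convex hull X = {}" using Krein_Milman_polytope[OF finX] by (simp add: H_def)
    thus False using \<open>X \<noteq> {}\<close> by (metis convex_hull_eq_empty)
  qed
  \<comment> \<open>At least one extreme point exists, so balance itself forces \<open>k\<close> to
    be large; small \<open>n\<close> need no separate treatment.\<close>
  hence k32: "k > 32" using hk by linarith
  have "real (card H) < real (card X)" using hk cX kn k1 by linarith
  hence "card H < card X" by simp
  then obtain p u v N where K: "{p, u, v} \<subseteq> H"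
      and W: "card X + N \<le> weight {p, u, v} (convex hull X) + 2"
      and N: "card X \<le> card H + card H * N\<^sup>2"
    using fan_gain[OF XR closed] unfolding H_def by blast
  \<comment> \<open>With \<open>N < 2 * k\<close>, fewer than \<open>k / 32\<close> fan triangles
    would account for at most a quarter of \<open>k ^ 3\<close>, the number of points, which is less
    than \<open>card X\<close>.\<close>
  have N2k: "real N \<ge> 2 * k"
  proof (rule ccontr)
    assume "\<not> ?thesis"
    hence "(real N)\<^sup>2 \<le> (2 * k)\<^sup>2" by (intro power_mono) auto
    hence "1 + (real N)\<^sup>2 \<le> 1 + 4 * k\<^sup>2" by (simp add: power_mult_distrib)
    also have "\<dots> \<le> 8 * k\<^sup>2" using one_le_power[OF k1, of 2] by linarith
    finally have le: "1 + (real N)\<^sup>2 \<le> 8 * k\<^sup>2" .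
    have "real (card X) \<le> real (card H) * (1 + (real N)\<^sup>2)"
      using of_nat_mono[OF N, where 'a = real] by (simp add: algebra_simps)
    also have "\<dots> \<le> (k / 32) * (8 * k\<^sup>2)"
      using hk le k1 by (intro mult_mono) auto
    also have "\<dots> = k ^ 3 / 4" by (simp add: power2_eq_square power3_eq_cube)
    finally show False using cX k3 by simp
  qed
  let ?t = "\<lambda>K. card (triangles_at K (convex hull X))"
  \<comment> \<open>Subtracting the blue points from the weight leaves more than
    \<open>N - 2 - k / 64\<close> triangles; \<open>k > 32\<close> absorbs both losses into the
    second \<open>k\<close>.\<close>
  have "real (?t {p, u, v}) \<ge> k"
  proof -
    have "real (card X) + real N \<le> real (?t {p, u, v}) + real b + 2"
      using W unfolding weight_def b_def by linarith
    thus ?thesis using N2k bal1 k32 by linarith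
  qed
  moreover have "?t {p, u, v} \<le> ?t {p} + ?t {u} + ?t {v}"
  proof -
    have "triangles_at {p, u, v} (convex hull X) =
        triangles_at {p} (convex hull X) \<union> triangles_at {u} (convex hull X) \<union> triangles_at {v} (convex hull X)"
      by (auto simp: triangles_at_def)
    moreover have "card (A \<union> A' \<union> A'') \<le> card A + card A' + card A''" for A A' A'' :: "(real^2) set set"
      by (meson card_Un_le order_trans add_right_mono)
    ultimately show ?thesis by simp
  qed
  ultimately have "k \<le> real (?t {p}) + real (?t {u}) + real (?t {v})" by linarith
  hence "\<exists>x\<in>{p, u, v}. 3 * real (?t {x}) \<ge> k" by auto
  then obtain x where x: "x \<in> {p, u, v}" "3 * real (?t {x}) \<ge> k" by blast
  have "x \<in> H" using x K by blast
  show ?thesis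
  proof (rule that)
    show "x \<in> X" using \<open>x \<in> H\<close> HX by blast
    show "x \<notin> convex hull (X - {x})"
      using \<open>x \<in> H\<close> extreme_point_notin_hull_remove by (auto simp: H_def)
  qed (use x in \<open>simp add: k_def\<close>)
qed

text \<open>Once \<open>X\<close> has at most a quarter of the points the bound is not positive.
  Otherwise delete a busy extreme point \<open>x\<close>: the triangles at \<open>x\<close> are
  disjoint from those within the rest, and they have their vertices in \<open>X\<close> because
  \<open>X\<close> contains all red points of its hull.\<close>

lemma balanced_imp_many_triangles:
  assumes "X \<subseteq> R" "R \<inter> convex hull X \<subseteq> X"
    and balanced: "\<And>C. convex C \<Longrightarrow> real (card (S \<inter> C)) \<ge> real (card S) / 8 \<Longrightarrow>
      discrepancy R B (S \<inter> C) < root 3 (real (card S)) / 64"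
  shows "3 * real (card {T \<in> empty_red_triangles S R. T \<subseteq> X})
     \<ge> (real (card X) - real (card S) / 4) * root 3 (real (card S))"
  using assms(1,2)
proof (induction "card X" arbitrary: X rule: less_induct)
  case less
  define k where "k = root 3 (real (card S))"
  have k0: "k \<ge> 0" by (simp add: k_def)
  have finX: "finite X" using less.prems finR finite_subset by blast
  show ?case
  proof (cases "4 * card X > card S")
    case False
    hence "real (card X) - real (card S) / 4 \<le> 0" by linarith
    hence "(real (card X) - real (card S) / 4) * k \<le> 0" using k0 by (simp add: mult_nonpos_nonneg)
    thus ?thesis unfolding k_def by (smt (verit) of_nat_0_le_iff)
  next
    case True
    obtain x where x: "x \<in> X" "x \<notin> convex hull (X - {x})"
        and t: "3 * real (card (triangles_at {x} (convex hull X))) \<ge> k"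
      using balanced_imp_busy_extreme_point[OF less.prems True balanced] unfolding k_def by blast
    let ?E = "\<lambda>X. {T \<in> empty_red_triangles S R. T \<subseteq> X}"
    have "convex hull (X - {x}) \<subseteq> convex hull X" by (intro hull_mono) auto
    hence closed: "R \<inter> convex hull (X - {x}) \<subseteq> X - {x}" using less.prems x by blast
    have cx: "card (X - {x}) < card X" using x finX by (meson card_Diff1_less)
    have IH: "3 * real (card (?E (X - {x}))) \<ge> (real (card (X - {x})) - real (card S) / 4) * k"
      using less.hyps[OF cx _ closed] less.prems unfolding k_def by blast
    have "?E (X - {x}) \<union> triangles_at {x} (convex hull X) \<subseteq> ?E X"
      using less.prems by (auto simp: triangles_at_def empty_red_triangles_def)
    moreover have "?E (X - {x}) \<inter> triangles_at {x} (convex hull X) = {}"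
      by (auto simp: triangles_at_def)
    ultimately have "card (?E (X - {x})) + card (triangles_at {x} (convex hull X)) \<le> card (?E X)"
      using finite_empty_red finite_triangles_at
        card_Un_disjoint[of "?E (X - {x})" "triangles_at {x} (convex hull X)"]
        card_mono[of "?E X" "?E (X - {x}) \<union> triangles_at {x} (convex hull X)"] by simp
    hence "real (card (?E (X - {x}))) + real (card (triangles_at {x} (convex hull X))) \<le> real (card (?E X))"
      by linarith
    moreover have "(real (card X) - real (card S) / 4) * k = (real (card (X - {x})) - real (card S) / 4) * k + k"
      using card.remove[OF finX x(1)] by (simp add: algebra_simps)
    ultimately show ?thesis using IH t unfolding k_def[symmetric] by linarith
  qed
qed

lemma many_triangles_or_unbalanced:
  "real (card (empty_red_triangles S R)) \<ge> 1/24 * real (card S) powr (4/3) \<or>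
   (\<exists>C. convex C \<and> real (card (S \<inter> C)) \<ge> 1/8 * real (card S) \<and>
        discrepancy R B (S \<inter> C) \<ge> 1/64 * root 3 (real (card S)))"
proof (rule disjCI)
  assume "\<not> (\<exists>C. convex C \<and> real (card (S \<inter> C)) \<ge> 1/8 * real (card S) \<and>
        discrepancy R B (S \<inter> C) \<ge> 1/64 * root 3 (real (card S)))"
  hence balanced: "discrepancy R B (S \<inter> C) < root 3 (real (card S)) / 64"
    if "convex C" "real (card (S \<inter> C)) \<ge> real (card S) / 8" for C
    using that by force
  show "real (card (empty_red_triangles S R)) \<ge> 1/24 * real (card S) powr (4/3)"
  proof (cases "card S = 0")
    case False
    define n k where "n = real (card S)" and "k = root 3 n"
    have n1: "n \<ge> 1" using False by (simp add: n_def)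
    have k3: "k ^ 3 = n" by (simp add: k_def n_def)
    have k1: "k \<ge> 1" using n1 by (simp add: k_def)
    have kn: "k \<le> n" using self_le_power[of k 3] k1 k3 by simp
    have "discrepancy R B S < k / 64" using balanced[of UNIV] by (simp add: n_def k_def)
    moreover have "S \<inter> R = R" "S \<inter> B = B" using RS BS by auto
    ultimately have "\<bar>real (card R) - real (card B)\<bar> < k / 64" by (simp add: discrepancy_def)
    moreover have "card R + card B = card S" using un disj finR finB card_Un_disjoint by metis
    hence "real (card R) + real (card B) = n" by (simp add: n_def flip: of_nat_add)
    \<comment> \<open>Balance of the whole set makes almost half of it red. So at least
      \<open>n / 8\<close> red points exceed the quarter, and with \<open>k / 3\<close> triangles
      for each this gives the constant 1/24.\<close>
    ultimately have "real (card R) - n / 4 \<ge> n / 8" using kn n1 by linarith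
    hence "n / 8 * k \<le> (real (card R) - n / 4) * k" using k1 by (intro mult_right_mono) auto
    also have "\<dots> \<le> 3 * real (card {T \<in> empty_red_triangles S R. T \<subseteq> R})"
      using balanced_imp_many_triangles[of R] balanced unfolding n_def k_def by blast
    also have "{T \<in> empty_red_triangles S R. T \<subseteq> R} = empty_red_triangles S R"
      by (auto simp: empty_red_triangles_def)
    finally have "n / 8 * k \<le> 3 * real (card (empty_red_triangles S R))" .
    moreover have "n powr (4/3) = n * k"
    proof -
      have "n powr (4/3) = n powr (1 + 1/3)" by simp
      also have "\<dots> = n * k" using n1 unfolding powr_add k_def by (simp add: root_powr_inverse)
      finally show ?thesis .
    qed
    ultimately show ?thesis by (simp add: n_def)
  qed simp
qed

end

theorem theorem31:
  "\<exists>a\<^sub>1 a\<^sub>2 a\<^sub>3 :: real. a\<^sub>1 > 0 \<and> a\<^sub>2 > 0 \<and> a\<^sub>3 > 0 \<and>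
     (\<forall>(n::nat) (S :: (real^2) set) R B.
        finite S \<and> card S = n \<and> general_position S \<and> R \<union> B = S \<and> R \<inter> B = {} \<longrightarrow>
          real (card (empty_red_triangles S R)) \<ge> a\<^sub>1 * real n powr (4/3) \<or>
          (\<exists>C. convex C \<and> real (card (S \<inter> C)) \<ge> a\<^sub>2 * real n \<and>
               discrepancy R B (S \<inter> C) \<ge> a\<^sub>3 * root 3 (real n)))"
proof (intro exI conjI allI impI)
  fix n :: nat and S R B :: "(real^2) set"
  assume "finite S \<and> card S = n \<and> general_position S \<and> R \<union> B = S \<and> R \<inter> B = {}"
  then interpret two_colored S R B by unfold_locales auto
  show "real (card (empty_red_triangles S R)) \<ge> 1/24 * real n powr (4/3) \<or>
          (\<exists>C. convex C \<and> real (card (S \<inter> C)) \<ge> 1/8 * real n \<and>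
               discrepancy R B (S \<inter> C) \<ge> 1/64 * root 3 (real n))"
    using many_triangles_or_unbalanced
      \<open>finite S \<and> card S = n \<and> general_position S \<and> R \<union> B = S \<and> R \<inter> B = {}\<close> by blast
qed auto

end
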